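(* Let $Q$ be a complete lattice with operations $\otimes,\oplus$ and elements $\top,\bot$ such that $(Q,\otimes,\top)$ and $(Q^{op},\oplus,\bot)$ are unital quantales. Then $(Q,\otimes,\top,\oplus,\bot)$ is an LD-quantale if and only if $Q\text{-}\mathsf{Rel}$, with the two compositions $\otimes,\oplus$ and identities $\top_X,\bot_X$ given in the context, is a linear quantaloid.
   Context: A unital quantale $(Q,\otimes,\top)$ is a complete lattice with an associative multiplication preserving arbitrary suprema in each variable and a two-sided unit; $Q^{op}$ is $Q$ with reversed order, so $(Q^{op},\oplus,\bot)$ being a quantale means $\oplus$ is associative with unit $\bot$ and preserves arbitrary infima of $Q$ in each variable. The top and bottom elements of $Q$ are $\mathbf 1,\mathbf 0$. An LD-quantale $(Q,\otimes,\top,\oplus,\bot)$ is a complete lattice such that $(Q,\otimes,\top)$ and $(Q^{op},\oplus,\bot)$ are unital quantales and, for all $a,b,c\in Q$, $a\otimes(b\oplus c)\le(a\otimes b)\oplus c$ and $(a\oplus b)\otimes c\le a\oplus(b\otimes c)$. A quantaloid is a category enriched in complete lattices and sup-preserving maps. Composition is written in diagrammatic order. A linear quantaloid is a locally small category $\mathcal Q$ whose hom-sets are complete lattices, with two composition operations $\otimes,\oplus$ and families of morphisms $\top_a,\bot_a\colon a\to a$, such that $(\mathcal Q,\otimes,\top_a)$ and $(\mathcal Q^{co},\oplus,\bot_a)$ are quantaloids ($\mathcal Q^{co}$ has the order on each hom-lattice reversed), and for all $f\colon a\to b$, $g\colon b\to c$, $h\colon c\to d$: $f\otimes(g\oplus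 h)\le(f\otimes g)\oplus h$ and $(f\oplus g)\otimes h\le f\oplus(g\otimes h)$. $Q\text{-}\mathsf{Rel}$: objects are sets; arrows $R\colon X\nrightarrow Y$ are functions $R\colon X\times Y\to Q$ ordered pointwise; for $R\colon X\nrightarrow Y$, $S\colon Y\nrightarrow Z$, $$(R\otimes S)(x,z)=\bigvee_{y\in Y}R(x,y)\otimes S(y,z),\qquad (R\oplus S)(x,z)=\bigwedge_{y\in Y}R(x,y)\oplus S(y,z);$$ $\top_X(x,x)=\top$, $\bot_X(x,x)=\bot$, and for $x\neq x'$, $\top_X(x,x')=\mathbf 0$, $\bot_X(x,x')=\mathbf 1$. *)

theory Defs
  imports "HOL-Algebra.Complete_Lattice"
begin

text \<open>
  Complete lattices are the partially ordered structures with carrier of HOL-Algebra. The operation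
  inv_gorder reverses the order of such a structure. It yields both the opposite lattice of a
  lattice and, applied to every hom-lattice, the dual on 2-cells of a quantaloid. In inv_gorder
  the suprema are the infima of the original order.
\<close>

locale unital_quantale = complete_lattice Q
  for Q :: "'q gorder" (structure)
    and mult :: "'q \<Rightarrow> 'q \<Rightarrow> 'q" (infixl \<open>\<odot>\<close> 70)
    and unit :: 'q (\<open>\<iota>\<close>) +
  assumes mult_closed: "\<lbrakk>a \<in> carrier Q; b \<in> carrier Q\<rbrakk> \<Longrightarrow> a \<odot> b \<in> carrier Q"
    and unit_closed: "\<iota> \<in> carrier Q"
    and mult_assoc: "\<lbrakk>a \<in> carrier Q; b \<in> carrier Q; c \<in> carrier Q\<rbrakk> \<Longrightarrow> (a \<odot> b) \<odot> c = a \<odot> (b \<odot> c)"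
    and unit_left: "a \<in> carrier Q \<Longrightarrow> \<iota> \<odot> a = a"
    and unit_right: "a \<in> carrier Q \<Longrightarrow> a \<odot> \<iota> = a"
    and mult_sup_pres_right: "a \<in> carrier Q \<Longrightarrow> sup_pres Q Q (\<lambda>b. a \<odot> b)"
    and mult_sup_pres_left: "b \<in> carrier Q \<Longrightarrow> sup_pres Q Q (\<lambda>a. a \<odot> b)"

locale LD_quantale =
  tensor: unital_quantale Q tensor tunit + par: unital_quantale "inv_gorder Q" par punit
  for Q :: "'q gorder"
    and tensor :: "'q \<Rightarrow> 'q \<Rightarrow> 'q" (infixl \<open>\<otimes>\<close> 70)
    and tunit :: 'q
    and par :: "'q \<Rightarrow> 'q \<Rightarrow> 'q" (infixl \<open>\<oplus>\<close> 70)
    and punit :: 'q +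
  assumes distrib_left:
      "\<lbrakk>a \<in> carrier Q; b \<in> carrier Q; c \<in> carrier Q\<rbrakk>
        \<Longrightarrow> a \<otimes> (b \<oplus> c) \<sqsubseteq>\<^bsub>Q\<^esub> (a \<otimes> b) \<oplus> c"
    and distrib_right:
      "\<lbrakk>a \<in> carrier Q; b \<in> carrier Q; c \<in> carrier Q\<rbrakk>
        \<Longrightarrow> (a \<oplus> b) \<otimes> c \<sqsubseteq>\<^bsub>Q\<^esub> a \<oplus> (b \<otimes> c)"

text \<open>
  Composition is in diagrammatic order: for objects a, b, c and arrows f from a to b and g from
  b to c, the composite from a to c is comp a b c f g. The three objects are explicit arguments
  because an arrow, being only an element of its hom-lattice, need not determine its domain and
  codomain (in the relational example below, a relation with empty domain does not determine its
  codomain).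
\<close>

locale quantaloid =
  fixes Ob :: "'o set"
    and hom :: "'o \<Rightarrow> 'o \<Rightarrow> 'm gorder"
    and comp :: "'o \<Rightarrow> 'o \<Rightarrow> 'o \<Rightarrow> 'm \<Rightarrow> 'm \<Rightarrow> 'm"
    and ident :: "'o \<Rightarrow> 'm"
  assumes hom_complete_lattice: "\<lbrakk>a \<in> Ob; b \<in> Ob\<rbrakk> \<Longrightarrow> complete_lattice (hom a b)"
    and comp_closed:
      "\<lbrakk>a \<in> Ob; b \<in> Ob; c \<in> Ob; f \<in> carrier (hom a b); g \<in> carrier (hom b c)\<rbrakk>
        \<Longrightarrow> comp a b c f g \<in> carrier (hom a c)"
    and ident_closed: "a \<in> Ob \<Longrightarrow> ident a \<in> carrier (hom a a)"
    and comp_assoc: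
      "\<lbrakk>a \<in> Ob; b \<in> Ob; c \<in> Ob; d \<in> Ob;
        f \<in> carrier (hom a b); g \<in> carrier (hom b c); h \<in> carrier (hom c d)\<rbrakk>
        \<Longrightarrow> comp a c d (comp a b c f g) h = comp a b d f (comp b c d g h)"
    and ident_left:
      "\<lbrakk>a \<in> Ob; b \<in> Ob; f \<in> carrier (hom a b)\<rbrakk> \<Longrightarrow> comp a a b (ident a) f = f"
    and ident_right:
      "\<lbrakk>a \<in> Ob; b \<in> Ob; f \<in> carrier (hom a b)\<rbrakk> \<Longrightarrow> comp a b b f (ident b) = f"
    and comp_sup_pres_right:
      "\<lbrakk>a \<in> Ob; b \<in> Ob; c \<in> Ob; f \<in> carrier (hom a b)\<rbrakk>
        \<Longrightarrow> sup_pres (hom b c) (hom a c) (\<lambda>g. comp a b c f g)"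
    and comp_sup_pres_left:
      "\<lbrakk>a \<in> Ob; b \<in> Ob; c \<in> Ob; g \<in> carrier (hom b c)\<rbrakk>
        \<Longrightarrow> sup_pres (hom a b) (hom a c) (\<lambda>f. comp a b c f g)"

locale linear_quantaloid =
  tensor: quantaloid Ob hom tensor tident +
  par: quantaloid Ob "\<lambda>a b. inv_gorder (hom a b)" par pident
  for Ob :: "'o set"
    and hom :: "'o \<Rightarrow> 'o \<Rightarrow> 'm gorder"
    and tensor :: "'o \<Rightarrow> 'o \<Rightarrow> 'o \<Rightarrow> 'm \<Rightarrow> 'm \<Rightarrow> 'm"
    and tident :: "'o \<Rightarrow> 'm"
    and par :: "'o \<Rightarrow> 'o \<Rightarrow> 'o \<Rightarrow> 'm \<Rightarrow> 'm \<Rightarrow> 'm"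
    and pident :: "'o \<Rightarrow> 'm" +
  assumes distrib_left:
      "\<lbrakk>a \<in> Ob; b \<in> Ob; c \<in> Ob; d \<in> Ob;
        f \<in> carrier (hom a b); g \<in> carrier (hom b c); h \<in> carrier (hom c d)\<rbrakk>
        \<Longrightarrow> tensor a b d f (par b c d g h) \<sqsubseteq>\<^bsub>hom a d\<^esub> par a c d (tensor a b c f g) h"
    and distrib_right:
      "\<lbrakk>a \<in> Ob; b \<in> Ob; c \<in> Ob; d \<in> Ob;
        f \<in> carrier (hom a b); g \<in> carrier (hom b c); h \<in> carrier (hom c d)\<rbrakk>
        \<Longrightarrow> tensor a c d (par a b c f g) h \<sqsubseteq>\<^bsub>hom a d\<^esub> par a b d f (tensor b c d g h)"

text \<open>
  The category of Q-valued relations. Since HOL has no type of all sets, its objects are all sets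
  with elements in a type 'u of arbitrary size, which plays the role of the universe of sets.
  A function on a product of sets is represented by its extension by the value undefined outside
  that product, so that equality of arrows is equality of functions on the product.
\<close>

definition QRel_hom :: "'q gorder \<Rightarrow> 'u set \<Rightarrow> 'u set \<Rightarrow> ('u \<times> 'u \<Rightarrow> 'q) gorder" where
  "QRel_hom Q X Y =
    \<lparr> carrier = X \<times> Y \<rightarrow>\<^sub>E carrier Q,
      eq = (=),
      le = (\<lambda>R S. \<forall>x\<in>X. \<forall>y\<in>Y. R (x, y) \<sqsubseteq>\<^bsub>Q\<^esub> S (x, y)) \<rparr>"

definition QRel_tensor ::
  "'q gorder \<Rightarrow> ('q \<Rightarrow> 'q \<Rightarrow> 'q) \<Rightarrow> 'u set \<Rightarrow> 'u set \<Rightarrow> 'u set \<Rightarrow>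
    ('u \<times> 'u \<Rightarrow> 'q) \<Rightarrow> ('u \<times> 'u \<Rightarrow> 'q) \<Rightarrow> ('u \<times> 'u \<Rightarrow> 'q)" where
  "QRel_tensor Q tensor X Y Z R S =
    (\<lambda>(x, z) \<in> X \<times> Z. SSUP\<^bsub>Q\<^esub> y:Y. tensor (R (x, y)) (S (y, z)))"

definition QRel_par ::
  "'q gorder \<Rightarrow> ('q \<Rightarrow> 'q \<Rightarrow> 'q) \<Rightarrow> 'u set \<Rightarrow> 'u set \<Rightarrow> 'u set \<Rightarrow>
    ('u \<times> 'u \<Rightarrow> 'q) \<Rightarrow> ('u \<times> 'u \<Rightarrow> 'q) \<Rightarrow> ('u \<times> 'u \<Rightarrow> 'q)" where
  "QRel_par Q par X Y Z R S =
    (\<lambda>(x, z) \<in> X \<times> Z. IINF\<^bsub>Q\<^esub> y:Y. par (R (x, y)) (S (y, z)))"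

text \<open>
  The off-diagonal values are the least and the greatest element of Q, which are unrelated to
  the units tunit and punit of the two multiplications.
\<close>

definition QRel_tident :: "'q gorder \<Rightarrow> 'q \<Rightarrow> 'u set \<Rightarrow> ('u \<times> 'u \<Rightarrow> 'q)" where
  "QRel_tident Q tunit X = (\<lambda>(x, x') \<in> X \<times> X. if x = x' then tunit else \<bottom>\<^bsub>Q\<^esub>)"

definition QRel_pident :: "'q gorder \<Rightarrow> 'q \<Rightarrow> 'u set \<Rightarrow> ('u \<times> 'u \<Rightarrow> 'q)" where
  "QRel_pident Q punit X = (\<lambda>(x, x') \<in> X \<times> X. if x = x' then punit else \<top>\<^bsub>Q\<^esub>)"

end

theory Submission
  imports Defs
begin

text \<open>
  For the forward direction, suprema and infima of relations are computed pointwise, so each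
  quantaloid law for relations reduces to the corresponding law of Q by distributing the
  multiplication over suprema and exchanging iterated suprema. Linear distributivity survives
  because the required inequality compares a supremum on the left with an infimum on the right,
  and hence may be checked one pair of middle points at a time. Reversing the order of Q and
  exchanging the two multiplications turns each law into its dual, so only half of them need an
  argument. For the converse, Q is the hom-lattice of endo-relations of a one-element set.
\<close>

subsection \<open>Indexed suprema\<close>

context complete_lattice
begin

lemma SSUP_closed:
  assumes "\<And>i. i \<in> I \<Longrightarrow> f i \<in> carrier L"
  shows "(SSUP\<^bsub>L\<^esub> i:I. f i) \<in> carrier L"
  unfolding supr_def by (rule sup_closed) (use assms in auto)

lemma SSUP_upper:
  assumes "\<And>i. i \<in> I \<Longrightarrow> f i \<in> carrier L" "i \<in> I"
  shows "f i \<sqsubseteq> (SSUP\<^bsub>L\<^esub> i:I. f i)"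
  unfolding supr_def by (rule sup_upper) (use assms in auto)

lemma SSUP_least:
  assumes "\<And>i. i \<in> I \<Longrightarrow> f i \<in> carrier L" "u \<in> carrier L" "\<And>i. i \<in> I \<Longrightarrow> f i \<sqsubseteq> u"
  shows "(SSUP\<^bsub>L\<^esub> i:I. f i) \<sqsubseteq> u"
  unfolding supr_def by (rule sup_least) (use assms in auto)

lemma IINF_closed:
  assumes "\<And>i. i \<in> I \<Longrightarrow> f i \<in> carrier L"
  shows "(IINF\<^bsub>L\<^esub> i:I. f i) \<in> carrier L"
  unfolding infi_def by (rule inf_closed) (use assms in auto)

lemma IINF_lower:
  assumes "\<And>i. i \<in> I \<Longrightarrow> f i \<in> carrier L" "i \<in> I"
  shows "(IINF\<^bsub>L\<^esub> i:I. f i) \<sqsubseteq> f i"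
  unfolding infi_def by (rule inf_lower) (use assms in auto)

lemma IINF_greatest:
  assumes "\<And>i. i \<in> I \<Longrightarrow> f i \<in> carrier L" "u \<in> carrier L" "\<And>i. i \<in> I \<Longrightarrow> u \<sqsubseteq> f i"
  shows "u \<sqsubseteq> (IINF\<^bsub>L\<^esub> i:I. f i)"
  unfolding infi_def by (rule inf_greatest) (use assms in auto)

text \<open>Each entry lies below the inner supremum over \<open>i\<close> at its own
  \<open>j\<close>, and that lies below the outer one. Exchanging the roles of \<open>I\<close> and
  \<open>J\<close> gives the reverse inequality.\<close>

lemma SSUP_swap_le:
  assumes "\<And>i j. i \<in> I \<Longrightarrow> j \<in> J \<Longrightarrow> f i j \<in> carrier L"
  shows "(SSUP\<^bsub>L\<^esub> i:I. SSUP\<^bsub>L\<^esub> j:J. f i j) \<sqsubseteq> (SSUP\<^bsub>L\<^esub> j:J. SSUP\<^bsub>L\<^esub> i:I. f i j)"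
proof (intro SSUP_least SSUP_closed)
  fix i j assume ij: "i \<in> I" "j \<in> J"
  have "f i j \<sqsubseteq> (SSUP\<^bsub>L\<^esub> i:I. f i j)"
    using assms ij by (intro SSUP_upper)
  also have "\<dots> \<sqsubseteq> (SSUP\<^bsub>L\<^esub> j:J. SSUP\<^bsub>L\<^esub> i:I. f i j)"
    using assms ij by (intro SSUP_upper[where f = "\<lambda>j. SSUP\<^bsub>L\<^esub> i:I. f i j"] SSUP_closed)
  finally show "f i j \<sqsubseteq> (SSUP\<^bsub>L\<^esub> j:J. SSUP\<^bsub>L\<^esub> i:I. f i j)"
    using assms ij by (simp add: SSUP_closed)
qed (use assms in auto)

lemma SSUP_swap:
  assumes "\<And>i j. i \<in> I \<Longrightarrow> j \<in> J \<Longrightarrow> f i j \<in> carrier L"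
  shows "(SSUP\<^bsub>L\<^esub> i:I. SSUP\<^bsub>L\<^esub> j:J. f i j) = (SSUP\<^bsub>L\<^esub> j:J. SSUP\<^bsub>L\<^esub> i:I. f i j)"
  by (rule le_antisym) (use assms in \<open>auto intro!: SSUP_swap_le SSUP_closed\<close>)

text \<open>Entries equal to the bottom do not affect a supremum. This is the shape that composition
  with an identity relation takes.\<close>

lemma SSUP_single:
  assumes "i \<in> I" "a \<in> carrier L"
  shows "(SSUP\<^bsub>L\<^esub> j:I. if i = j then a else \<bottom>) = a"
proof (rule le_antisym)
  show "(SSUP\<^bsub>L\<^esub> j:I. if i = j then a else \<bottom>) \<sqsubseteq> a"
    using assms by (intro SSUP_least) auto
  show "a \<sqsubseteq> (SSUP\<^bsub>L\<^esub> j:I. if i = j then a else \<bottom>)"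
    using assms SSUP_upper[of I "\<lambda>j. if i = j then a else \<bottom>" i] by auto
qed (use assms in \<open>auto intro!: SSUP_closed\<close>)

text \<open>Encodes the order by a supremum, so that preservation of suprema yields
  monotonicity.\<close>

lemma SSUP_pair:
  assumes "b \<in> carrier L" "c \<in> carrier L" "b \<sqsubseteq> c"
  shows "(SSUP\<^bsub>L\<^esub> x:{b, c}. x) = c"
proof (rule le_antisym)
  show "(SSUP\<^bsub>L\<^esub> x:{b, c}. x) \<sqsubseteq> c" using assms by (intro SSUP_least) auto
  show "c \<sqsubseteq> (SSUP\<^bsub>L\<^esub> x:{b, c}. x)"
    using assms by (intro SSUP_upper[of "{b, c}" "\<lambda>x. x"]) auto
qed (use assms in \<open>auto intro!: SSUP_closed\<close>)

lemma sup_empty_eq_bottom: "\<Squnion>{} = \<bottom>"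
  using weak_sup_empty by (simp only: eq_is_equal)

text \<open>Existence of suprema and existence of infima trade places when the order is reversed.
  Infima of relations are later obtained as suprema over this dual.\<close>

lemma dual_complete_lattice: "complete_lattice (inv_gorder L)"
proof -
  interpret dual: weak_complete_lattice "inv_gorder L"
    by (rule dual_weak_complete_lattice)
  show ?thesis
  proof
    show "(.=\<^bsub>inv_gorder L\<^esub>) = (=)"
      by (simp add: eq_is_equal)
  qed (simp_all add: sup_exists inf_exists del: eq_is_equal)
qed

end

text \<open>As a congruence rule, it lets the body be rewritten under the assumption that the index
  lies in the index set, which the pointwise formulas for composites require.\<close>

lemma SSUP_cong:
  assumes "\<And>i. i \<in> I \<Longrightarrow> f i = g i"
  shows "(SSUP\<^bsub>L\<^esub> i:I. f i) = (SSUP\<^bsub>L\<^esub> i:I. g i)"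
  unfolding supr_def using assms by (metis image_cong)

lemma IINF_cong:
  assumes "\<And>i. i \<in> I \<Longrightarrow> f i = g i"
  shows "(IINF\<^bsub>L\<^esub> i:I. f i) = (IINF\<^bsub>L\<^esub> i:I. g i)"
  unfolding infi_def using assms by (metis image_cong)

section \<open>Distributivity and monotonicity of quantale multiplication\<close>

context unital_quantale
begin

lemma mult_SSUP_right:
  assumes "a \<in> carrier Q" "\<And>i. i \<in> I \<Longrightarrow> f i \<in> carrier Q"
  shows "a \<odot> (SSUP\<^bsub>Q\<^esub> i:I. f i) = (SSUP\<^bsub>Q\<^esub> i:I. a \<odot> f i)"
proof -
  have "f ` I \<subseteq> carrier Q" using assms by auto
  then show ?thesis
    using mult_sup_pres_right[OF assms(1)] by (simp add: sup_pres_def supr_def image_image)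
qed

lemma mult_SSUP_left:
  assumes "a \<in> carrier Q" "\<And>i. i \<in> I \<Longrightarrow> f i \<in> carrier Q"
  shows "(SSUP\<^bsub>Q\<^esub> i:I. f i) \<odot> a = (SSUP\<^bsub>Q\<^esub> i:I. f i \<odot> a)"
proof -
  have "f ` I \<subseteq> carrier Q" using assms by auto
  then show ?thesis
    using mult_sup_pres_left[OF assms(1)] by (simp add: sup_pres_def supr_def image_image)
qed

text \<open>The bottom is the empty supremum, and \<open>sup_pres\<close> covers the empty
  set.\<close>

lemma mult_bottom_right: "a \<in> carrier Q \<Longrightarrow> a \<odot> \<bottom> = \<bottom>"
  using mult_SSUP_right[of a "{}"] by (simp add: supr_def sup_empty_eq_bottom)

lemma mult_bottom_left: "a \<in> carrier Q \<Longrightarrow> \<bottom> \<odot> a = \<bottom>"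
  using mult_SSUP_left[of a "{}"] by (simp add: supr_def sup_empty_eq_bottom)

text \<open>If \<open>b\<close> is below \<open>c\<close>, then \<open>c\<close> is the supremum of
  the pair; multiplication by \<open>a\<close> preserves this supremum, which bounds the product
  with \<open>b\<close>.\<close>

lemma mult_mono_right:
  assumes "a \<in> carrier Q" "b \<in> carrier Q" "c \<in> carrier Q" "b \<sqsubseteq> c"
  shows "a \<odot> b \<sqsubseteq> a \<odot> c"
proof -
  have "a \<odot> b \<sqsubseteq> (SSUP\<^bsub>Q\<^esub> x:{b, c}. a \<odot> x)"
    using assms by (intro SSUP_upper) (auto intro: mult_closed)
  also have "\<dots> = a \<odot> (SSUP\<^bsub>Q\<^esub> x:{b, c}. x)"
    using assms by (intro mult_SSUP_right[symmetric]) auto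
  finally show ?thesis using assms by (simp add: SSUP_pair)
qed

lemma mult_mono_left:
  assumes "a \<in> carrier Q" "b \<in> carrier Q" "c \<in> carrier Q" "b \<sqsubseteq> c"
  shows "b \<odot> a \<sqsubseteq> c \<odot> a"
proof -
  have "b \<odot> a \<sqsubseteq> (SSUP\<^bsub>Q\<^esub> x:{b, c}. x \<odot> a)"
    using assms by (intro SSUP_upper) (auto intro: mult_closed)
  also have "\<dots> = (SSUP\<^bsub>Q\<^esub> x:{b, c}. x) \<odot> a"
    using assms by (intro mult_SSUP_left[symmetric]) auto
  finally show ?thesis using assms by (simp add: SSUP_pair)
qed

end

subsection \<open>The quantaloid of relations\<close>

lemma QRel_hom_carrier [simp]: "carrier (QRel_hom Q X Y) = X \<times> Y \<rightarrow>\<^sub>E carrier Q"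
  by (simp add: QRel_hom_def)

lemma QRel_hom_eq [simp]: "eq (QRel_hom Q X Y) = (=)"
  by (simp add: QRel_hom_def)

lemma QRel_hom_le [simp]:
  "R \<sqsubseteq>\<^bsub>QRel_hom Q X Y\<^esub> S \<longleftrightarrow> (\<forall>x\<in>X. \<forall>y\<in>Y. R (x, y) \<sqsubseteq>\<^bsub>Q\<^esub> S (x, y))"
  by (simp add: QRel_hom_def)

text \<open>Together with the next three lemmas this is a dictionary: relations over the reversed
  order have reversed hom-lattices, their suprema are infima over \<open>Q\<close>, and the bottom
  off the diagonal becomes the top. Every result about \<open>QRel_tensor\<close> thereby has a
  counterpart for \<open>QRel_par\<close>.\<close>

lemma QRel_hom_dual: "QRel_hom (inv_gorder Q) X Y = inv_gorder (QRel_hom Q X Y)"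
  by (simp add: QRel_hom_def)

lemma QRel_tensor_dual: "QRel_tensor (inv_gorder Q) = QRel_par Q"
  by (intro ext) (simp add: QRel_tensor_def QRel_par_def supr_def infi_def)

lemma QRel_par_dual: "QRel_par (inv_gorder Q) = QRel_tensor Q"
  by (intro ext) (simp add: QRel_tensor_def QRel_par_def supr_def infi_def)

lemma QRel_tident_dual: "QRel_tident (inv_gorder Q) = QRel_pident Q"
  unfolding QRel_tident_def QRel_pident_def bottom_dual ..

lemma QRel_memD: "R \<in> X \<times> Y \<rightarrow>\<^sub>E A \<Longrightarrow> x \<in> X \<Longrightarrow> y \<in> Y \<Longrightarrow> R (x, y) \<in> A"
  by (auto simp: PiE_def Pi_def)

lemma QRel_eqI:
  assumes "R \<in> X \<times> Y \<rightarrow>\<^sub>E A" "S \<in> X \<times> Y \<rightarrow>\<^sub>E A"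
    and "\<And>x y. x \<in> X \<Longrightarrow> y \<in> Y \<Longrightarrow> R (x, y) = S (x, y)"
  shows "R = S"
  by (rule PiE_ext[OF assms(1,2)]) (use assms(3) in auto)

lemma QRel_tensor_apply:
  "x \<in> X \<Longrightarrow> z \<in> Z \<Longrightarrow>
    QRel_tensor Q tensor X Y Z R S (x, z) = (SSUP\<^bsub>Q\<^esub> y:Y. tensor (R (x, y)) (S (y, z)))"
  by (simp add: QRel_tensor_def)

lemma QRel_par_apply:
  "x \<in> X \<Longrightarrow> z \<in> Z \<Longrightarrow>
    QRel_par Q par X Y Z R S (x, z) = (IINF\<^bsub>Q\<^esub> y:Y. par (R (x, y)) (S (y, z)))"
  by (simp add: QRel_par_def)

section \<open>Completeness of the hom-lattices\<close>

lemma QRel_hom_partial_order: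
  assumes "complete_lattice L"
  shows "partial_order (QRel_hom L X Y)"
proof -
  interpret complete_lattice L by (rule assms)
  show ?thesis
  proof
    fix R S assume "R \<in> carrier (QRel_hom L X Y)" "S \<in> carrier (QRel_hom L X Y)"
      "R \<sqsubseteq>\<^bsub>QRel_hom L X Y\<^esub> S" "S \<sqsubseteq>\<^bsub>QRel_hom L X Y\<^esub> R"
    \<comment> \<open>Pointwise antisymmetry suffices, since both relations are
      \<open>undefined\<close> outside the product.\<close>
    then have "R = S"
      unfolding QRel_hom_le QRel_hom_carrier
      by (intro QRel_eqI[where A = "carrier L"]) (auto intro!: le_antisym simp: QRel_memD)
    then show "R .=\<^bsub>QRel_hom L X Y\<^esub> S"
      by simp
  next
    fix R S T assume "R \<in> carrier (QRel_hom L X Y)" "S \<in> carrier (QRel_hom L X Y)"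
      "T \<in> carrier (QRel_hom L X Y)" "R \<sqsubseteq>\<^bsub>QRel_hom L X Y\<^esub> S" "S \<sqsubseteq>\<^bsub>QRel_hom L X Y\<^esub> T"
    then show "R \<sqsubseteq>\<^bsub>QRel_hom L X Y\<^esub> T"
      unfolding QRel_hom_le QRel_hom_carrier by (blast intro: le_trans QRel_memD)
  qed (auto intro: QRel_memD)
qed

text \<open>Upper bounds in the pointwise order are upper bounds at every pair. The restricted
  abstraction makes the pointwise supremum extensional, hence an arrow.\<close>

lemma QRel_lub:
  assumes "complete_lattice L" and \<R>: "\<R> \<subseteq> carrier (QRel_hom L X Y)"
  shows "is_lub (QRel_hom L X Y) (\<lambda>p\<in>X \<times> Y. SSUP\<^bsub>L\<^esub> R:\<R>. R p) \<R>"
proof (rule least_UpperI)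
  interpret complete_lattice L by (rule assms(1))
  have mem: "R p \<in> carrier L" if "R \<in> \<R>" "p \<in> X \<times> Y" for R p
    using \<R> that by (auto simp: PiE_def Pi_def)
  then show "(\<lambda>p\<in>X \<times> Y. SSUP\<^bsub>L\<^esub> R:\<R>. R p) \<in> carrier (QRel_hom L X Y)"
    by (auto intro!: SSUP_closed)
  show "R \<sqsubseteq>\<^bsub>QRel_hom L X Y\<^esub> (\<lambda>p\<in>X \<times> Y. SSUP\<^bsub>L\<^esub> R:\<R>. R p)" if "R \<in> \<R>" for R
    using that mem by (auto intro!: SSUP_upper[where f = "\<lambda>R. R _"])
  show "(\<lambda>p\<in>X \<times> Y. SSUP\<^bsub>L\<^esub> R:\<R>. R p) \<sqsubseteq>\<^bsub>QRel_hom L X Y\<^esub> U"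
    if "U \<in> Upper (QRel_hom L X Y) \<R>" for U
  proof -
    have "U \<in> X \<times> Y \<rightarrow>\<^sub>E carrier L"
      and "\<And>R x y. R \<in> \<R> \<Longrightarrow> x \<in> X \<Longrightarrow> y \<in> Y \<Longrightarrow> R (x, y) \<sqsubseteq>\<^bsub>L\<^esub> U (x, y)"
      using that \<R> unfolding Upper_def by auto
    then show ?thesis
      using mem by (auto intro!: SSUP_least dest: QRel_memD)
  qed
qed (use \<R> in auto)

lemma QRel_hom_complete_lattice:
  assumes "complete_lattice L"
  shows "complete_lattice (QRel_hom L X Y)"
proof -
  interpret hom: partial_order "QRel_hom L X Y"
    by (rule QRel_hom_partial_order[OF assms])
  show ?thesis
  proof
    fix \<R> assume \<R>: "\<R> \<subseteq> carrier (QRel_hom L X Y)"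
    then show "\<exists>s. is_lub (QRel_hom L X Y) s \<R>"
      by (blast intro: QRel_lub assms)
    \<comment> \<open>Reversing the order leaves the carrier unchanged, so a least upper bound over
      the dual of \<open>L\<close> is a greatest lower bound over \<open>L\<close>.\<close>
    have "\<R> \<subseteq> carrier (QRel_hom (inv_gorder L) X Y)"
      using \<R> by simp
    from QRel_lub[OF complete_lattice.dual_complete_lattice[OF assms] this]
    show "\<exists>i. is_glb (QRel_hom L X Y) i \<R>"
      unfolding QRel_hom_dual Upper_dual least_dual by blast
  qed
qed

text \<open>Least upper bounds in a partial order are unique, so the chosen supremum is the
  pointwise one.\<close>

lemma QRel_sup:
  assumes "complete_lattice L" and \<R>: "\<R> \<subseteq> carrier (QRel_hom L X Y)"
  shows "\<Squnion>\<^bsub>QRel_hom L X Y\<^esub> \<R> = (\<lambda>p\<in>X \<times> Y. SSUP\<^bsub>L\<^esub> R:\<R>. R p)"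
proof -
  interpret hom: complete_lattice "QRel_hom L X Y"
    by (rule QRel_hom_complete_lattice[OF assms(1)])
  show ?thesis
    using hom.weak_least_unique[OF hom.sup_lub[OF \<R>] QRel_lub[OF assms]] by simp
qed

section \<open>Laws of relational composition\<close>

context unital_quantale
begin

lemma QRel_tensor_closed:
  assumes "R \<in> X \<times> Y \<rightarrow>\<^sub>E carrier Q" "S \<in> Y \<times> Z \<rightarrow>\<^sub>E carrier Q"
  shows "QRel_tensor Q (\<odot>) X Y Z R S \<in> X \<times> Z \<rightarrow>\<^sub>E carrier Q"
  using assms unfolding QRel_tensor_def
  by (auto intro!: SSUP_closed mult_closed dest: QRel_memD)

lemma QRel_tident_closed: "QRel_tident Q \<iota> X \<in> X \<times> X \<rightarrow>\<^sub>E carrier Q"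
  unfolding QRel_tident_def by (auto intro: unit_closed)

text \<open>Distributing the multiplication over the inner supremum turns both sides into double
  suprema over the middle points \<open>y\<close> and \<open>z\<close>; they agree by exchanging the
  suprema and by associativity in \<open>Q\<close>.\<close>

lemma QRel_tensor_assoc:
  assumes R: "R \<in> X \<times> Y \<rightarrow>\<^sub>E carrier Q" and S: "S \<in> Y \<times> Z \<rightarrow>\<^sub>E carrier Q"
    and T: "T \<in> Z \<times> W \<rightarrow>\<^sub>E carrier Q"
  shows "QRel_tensor Q (\<odot>) X Z W (QRel_tensor Q (\<odot>) X Y Z R S) T =
    QRel_tensor Q (\<odot>) X Y W R (QRel_tensor Q (\<odot>) Y Z W S T)"
proof (rule QRel_eqI[where A = "carrier Q"])
  fix x w assume xw: "x \<in> X" "w \<in> W"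
  note mem = QRel_memD[OF R xw(1)] QRel_memD[OF S] QRel_memD[OF T _ xw(2)] mult_closed
  have "QRel_tensor Q (\<odot>) X Z W (QRel_tensor Q (\<odot>) X Y Z R S) T (x, w) =
      (SSUP\<^bsub>Q\<^esub> z:Z. (SSUP\<^bsub>Q\<^esub> y:Y. R (x, y) \<odot> S (y, z)) \<odot> T (z, w))"
    using xw by (simp add: QRel_tensor_apply cong: SSUP_cong)
  also have "\<dots> = (SSUP\<^bsub>Q\<^esub> z:Z. SSUP\<^bsub>Q\<^esub> y:Y. (R (x, y) \<odot> S (y, z)) \<odot> T (z, w))"
    by (intro SSUP_cong mult_SSUP_left) (auto intro!: mem)
  also have "\<dots> = (SSUP\<^bsub>Q\<^esub> y:Y. SSUP\<^bsub>Q\<^esub> z:Z. (R (x, y) \<odot> S (y, z)) \<odot> T (z, w))"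
    by (rule SSUP_swap) (auto intro!: mem)
  also have "\<dots> = (SSUP\<^bsub>Q\<^esub> y:Y. SSUP\<^bsub>Q\<^esub> z:Z. R (x, y) \<odot> (S (y, z) \<odot> T (z, w)))"
    by (intro SSUP_cong mult_assoc) (auto intro!: mem)
  also have "\<dots> = (SSUP\<^bsub>Q\<^esub> y:Y. R (x, y) \<odot> (SSUP\<^bsub>Q\<^esub> z:Z. S (y, z) \<odot> T (z, w)))"
    by (intro SSUP_cong mult_SSUP_right[symmetric]) (auto intro!: mem)
  also have "\<dots> = QRel_tensor Q (\<odot>) X Y W R (QRel_tensor Q (\<odot>) Y Z W S T) (x, w)"
    using xw by (simp add: QRel_tensor_apply cong: SSUP_cong)
  finally show "QRel_tensor Q (\<odot>) X Z W (QRel_tensor Q (\<odot>) X Y Z R S) T (x, w) =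
    QRel_tensor Q (\<odot>) X Y W R (QRel_tensor Q (\<odot>) Y Z W S T) (x, w)" .
qed (intro QRel_tensor_closed R S T)+

text \<open>Off the diagonal the identity is the bottom, which annihilates, so only the term with
  \<open>x' = x\<close> contributes.\<close>

lemma QRel_tensor_tident_left:
  assumes R: "R \<in> X \<times> Y \<rightarrow>\<^sub>E carrier Q"
  shows "QRel_tensor Q (\<odot>) X X Y (QRel_tident Q \<iota> X) R = R"
proof (rule QRel_eqI[where A = "carrier Q"])
  fix x y assume xy: "x \<in> X" "y \<in> Y"
  have "QRel_tensor Q (\<odot>) X X Y (QRel_tident Q \<iota> X) R (x, y) =
      (SSUP\<^bsub>Q\<^esub> x':X. if x = x' then R (x, y) else \<bottom>)"
    unfolding QRel_tensor_apply[OF xy]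
    by (intro SSUP_cong)
      (use xy QRel_memD[OF R] in \<open>auto simp: QRel_tident_def unit_left mult_bottom_left\<close>)
  also have "\<dots> = R (x, y)"
    using xy QRel_memD[OF R] by (intro SSUP_single)
  finally show "QRel_tensor Q (\<odot>) X X Y (QRel_tident Q \<iota> X) R (x, y) = R (x, y)" .
qed (intro QRel_tensor_closed QRel_tident_closed R)+

lemma QRel_tensor_tident_right:
  assumes R: "R \<in> X \<times> Y \<rightarrow>\<^sub>E carrier Q"
  shows "QRel_tensor Q (\<odot>) X Y Y R (QRel_tident Q \<iota> Y) = R"
proof (rule QRel_eqI[where A = "carrier Q"])
  fix x y assume xy: "x \<in> X" "y \<in> Y"
  have "QRel_tensor Q (\<odot>) X Y Y R (QRel_tident Q \<iota> Y) (x, y) =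
      (SSUP\<^bsub>Q\<^esub> y':Y. if y = y' then R (x, y) else \<bottom>)"
    unfolding QRel_tensor_apply[OF xy]
    by (intro SSUP_cong)
      (use xy QRel_memD[OF R] in \<open>auto simp: QRel_tident_def unit_right mult_bottom_right\<close>)
  also have "\<dots> = R (x, y)"
    using xy QRel_memD[OF R] by (intro SSUP_single)
  finally show "QRel_tensor Q (\<odot>) X Y Y R (QRel_tident Q \<iota> Y) (x, y) = R (x, y)" .
qed (intro QRel_tensor_closed QRel_tident_closed R)+

text \<open>Since suprema of relations are pointwise, distributivity in \<open>Q\<close> moves the
  supremum over the family outside the product, and it then commutes with the supremum over middle
  points.\<close>

lemma QRel_tensor_sup_right:
  assumes R: "R \<in> X \<times> Y \<rightarrow>\<^sub>E carrier Q" and \<S>: "\<S> \<subseteq> Y \<times> Z \<rightarrow>\<^sub>E carrier Q"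
  shows "QRel_tensor Q (\<odot>) X Y Z R (\<Squnion>\<^bsub>QRel_hom Q Y Z\<^esub> \<S>) =
    \<Squnion>\<^bsub>QRel_hom Q X Z\<^esub> (QRel_tensor Q (\<odot>) X Y Z R ` \<S>)"
proof -
  have "QRel_tensor Q (\<odot>) X Y Z R ` \<S> \<subseteq> X \<times> Z \<rightarrow>\<^sub>E carrier Q"
    using \<S> R by (auto intro!: QRel_tensor_closed)
  then have rhs: "\<Squnion>\<^bsub>QRel_hom Q X Z\<^esub> (QRel_tensor Q (\<odot>) X Y Z R ` \<S>) =
      (\<lambda>p\<in>X \<times> Z. SSUP\<^bsub>Q\<^esub> S:\<S>. QRel_tensor Q (\<odot>) X Y Z R S p)"
    by (simp add: QRel_sup[OF complete_lattice_axioms] supr_def image_image)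
  have "QRel_tensor Q (\<odot>) X Y Z R (\<Squnion>\<^bsub>QRel_hom Q Y Z\<^esub> \<S>) (x, z) =
      (SSUP\<^bsub>Q\<^esub> S:\<S>. QRel_tensor Q (\<odot>) X Y Z R S (x, z))" if xz: "x \<in> X" "z \<in> Z" for x z
  proof -
    have mem: "R (x, y) \<in> carrier Q" "S \<in> \<S> \<Longrightarrow> S (y, z) \<in> carrier Q" if "y \<in> Y" for y S
      using R \<S> xz that by (auto dest: QRel_memD)
    have "QRel_tensor Q (\<odot>) X Y Z R (\<Squnion>\<^bsub>QRel_hom Q Y Z\<^esub> \<S>) (x, z) =
        (SSUP\<^bsub>Q\<^esub> y:Y. R (x, y) \<odot> (SSUP\<^bsub>Q\<^esub> S:\<S>. S (y, z)))"
      using xz \<S> by (simp add: QRel_tensor_apply QRel_sup[OF complete_lattice_axioms] cong: SSUP_cong)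
    also have "\<dots> = (SSUP\<^bsub>Q\<^esub> y:Y. SSUP\<^bsub>Q\<^esub> S:\<S>. R (x, y) \<odot> S (y, z))"
      by (intro SSUP_cong mult_SSUP_right) (auto intro!: mem)
    also have "\<dots> = (SSUP\<^bsub>Q\<^esub> S:\<S>. SSUP\<^bsub>Q\<^esub> y:Y. R (x, y) \<odot> S (y, z))"
      by (rule SSUP_swap) (auto intro!: mem mult_closed)
    finally show ?thesis
      using xz by (simp add: QRel_tensor_apply)
  qed
  \<comment> \<open>Outside the product of \<open>X\<close> and \<open>Z\<close> both sides are
    \<open>undefined\<close>.\<close>
  then show ?thesis
    unfolding rhs by (auto simp: QRel_tensor_def fun_eq_iff)
qed

lemma QRel_tensor_sup_left:
  assumes S: "S \<in> Y \<times> Z \<rightarrow>\<^sub>E carrier Q" and \<R>: "\<R> \<subseteq> X \<times> Y \<rightarrow>\<^sub>E carrier Q"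
  shows "QRel_tensor Q (\<odot>) X Y Z (\<Squnion>\<^bsub>QRel_hom Q X Y\<^esub> \<R>) S =
    \<Squnion>\<^bsub>QRel_hom Q X Z\<^esub> ((\<lambda>R. QRel_tensor Q (\<odot>) X Y Z R S) ` \<R>)"
proof -
  have "(\<lambda>R. QRel_tensor Q (\<odot>) X Y Z R S) ` \<R> \<subseteq> X \<times> Z \<rightarrow>\<^sub>E carrier Q"
    using \<R> S by (auto intro!: QRel_tensor_closed)
  then have rhs: "\<Squnion>\<^bsub>QRel_hom Q X Z\<^esub> ((\<lambda>R. QRel_tensor Q (\<odot>) X Y Z R S) ` \<R>) =
      (\<lambda>p\<in>X \<times> Z. SSUP\<^bsub>Q\<^esub> R:\<R>. QRel_tensor Q (\<odot>) X Y Z R S p)"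
    by (simp add: QRel_sup[OF complete_lattice_axioms] supr_def image_image)
  have "QRel_tensor Q (\<odot>) X Y Z (\<Squnion>\<^bsub>QRel_hom Q X Y\<^esub> \<R>) S (x, z) =
      (SSUP\<^bsub>Q\<^esub> R:\<R>. QRel_tensor Q (\<odot>) X Y Z R S (x, z))" if xz: "x \<in> X" "z \<in> Z" for x z
  proof -
    have mem: "S (y, z) \<in> carrier Q" "R \<in> \<R> \<Longrightarrow> R (x, y) \<in> carrier Q" if "y \<in> Y" for y R
      using S \<R> xz that by (auto dest: QRel_memD)
    have "QRel_tensor Q (\<odot>) X Y Z (\<Squnion>\<^bsub>QRel_hom Q X Y\<^esub> \<R>) S (x, z) =
        (SSUP\<^bsub>Q\<^esub> y:Y. (SSUP\<^bsub>Q\<^esub> R:\<R>. R (x, y)) \<odot> S (y, z))"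
      using xz \<R> by (simp add: QRel_tensor_apply QRel_sup[OF complete_lattice_axioms] cong: SSUP_cong)
    also have "\<dots> = (SSUP\<^bsub>Q\<^esub> y:Y. SSUP\<^bsub>Q\<^esub> R:\<R>. R (x, y) \<odot> S (y, z))"
      by (intro SSUP_cong mult_SSUP_left) (auto intro!: mem)
    also have "\<dots> = (SSUP\<^bsub>Q\<^esub> R:\<R>. SSUP\<^bsub>Q\<^esub> y:Y. R (x, y) \<odot> S (y, z))"
      by (rule SSUP_swap) (auto intro!: mem mult_closed)
    finally show ?thesis
      using xz by (simp add: QRel_tensor_apply)
  qed
  then show ?thesis
    unfolding rhs by (auto simp: QRel_tensor_def fun_eq_iff)
qed

lemma QRel_quantaloid:
  "quantaloid \<O> (QRel_hom Q) (QRel_tensor Q (\<odot>)) (QRel_tident Q \<iota>)"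
  unfolding quantaloid_def sup_pres_def QRel_hom_carrier
  by (intro conjI allI impI QRel_hom_complete_lattice complete_lattice_axioms QRel_tensor_closed
      QRel_tident_closed QRel_tensor_assoc QRel_tensor_tident_left QRel_tensor_tident_right
      QRel_tensor_sup_right QRel_tensor_sup_left; assumption?)+

end

text \<open>This is the quantaloid of relations over the reversed order, translated by the duality
  dictionary.\<close>

lemma QRel_par_quantaloid:
  assumes "unital_quantale (inv_gorder Q) par punit"
  shows "quantaloid \<O> (\<lambda>X Y. inv_gorder (QRel_hom Q X Y)) (QRel_par Q par) (QRel_pident Q punit)"
  using unital_quantale.QRel_quantaloid[OF assms, of \<O>]
  by (simp add: QRel_hom_dual[abs_def] QRel_tensor_dual QRel_tident_dual)

subsection \<open>Linear distributivity\<close>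

text \<open>Reversing the order while exchanging the two multiplications turns each linear
  distributive law into the other one.\<close>

lemma LD_quantale_dual:
  assumes "LD_quantale Q tensor tunit par punit"
  shows "LD_quantale (inv_gorder Q) par punit tensor tunit"
proof -
  interpret LD_quantale Q tensor tunit par punit by (rule assms)
  show ?thesis
    unfolding LD_quantale_def LD_quantale_axioms_def inv_gorder_inv
    using tensor.unital_quantale_axioms par.unital_quantale_axioms distrib_left distrib_right
    by simp
qed

lemma (in LD_quantale) QRel_distrib_left:
  assumes R: "R \<in> X \<times> Y \<rightarrow>\<^sub>E carrier Q" and S: "S \<in> Y \<times> Z \<rightarrow>\<^sub>E carrier Q"
    and T: "T \<in> Z \<times> W \<rightarrow>\<^sub>E carrier Q"
  shows "QRel_tensor Q (\<otimes>) X Y W R (QRel_par Q (\<oplus>) Y Z W S T)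
    \<sqsubseteq>\<^bsub>QRel_hom Q X W\<^esub> QRel_par Q (\<oplus>) X Z W (QRel_tensor Q (\<otimes>) X Y Z R S) T"
proof -
  note par_closed = par.mult_closed[simplified]
  have pointwise: "R (x, y) \<otimes> (IINF\<^bsub>Q\<^esub> z:Z. S (y, z) \<oplus> T (z, w))
      \<sqsubseteq>\<^bsub>Q\<^esub> (SSUP\<^bsub>Q\<^esub> y:Y. R (x, y) \<otimes> S (y, z)) \<oplus> T (z, w)"
    if "x \<in> X" "y \<in> Y" "z \<in> Z" "w \<in> W" for x y z w
  proof -
    note mem = QRel_memD[OF R that(1)] QRel_memD[OF S] QRel_memD[OF T _ that(4)]
      tensor.mult_closed par_closed tensor.SSUP_closed tensor.IINF_closed that
    \<comment> \<open>With \<open>y\<close> and \<open>z\<close> fixed, the infimum is bounded by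
      its term at \<open>z\<close>, the law of \<open>Q\<close> is applied, and the term at
      \<open>y\<close> is enlarged to the supremum.\<close>
    have "R (x, y) \<otimes> (IINF\<^bsub>Q\<^esub> z:Z. S (y, z) \<oplus> T (z, w))
        \<sqsubseteq>\<^bsub>Q\<^esub> R (x, y) \<otimes> (S (y, z) \<oplus> T (z, w))"
      by (intro tensor.mult_mono_right tensor.IINF_lower[where f = "\<lambda>z. S (y, z) \<oplus> T (z, w)"] mem)
    also have "\<dots> \<sqsubseteq>\<^bsub>Q\<^esub> (R (x, y) \<otimes> S (y, z)) \<oplus> T (z, w)"
      by (intro distrib_left mem)
    \<comment> \<open>Monotonicity for the reversed order, read backwards, is monotonicity of
      \<open>par\<close> in \<open>Q\<close>.\<close>
    also have "\<dots> \<sqsubseteq>\<^bsub>Q\<^esub> (SSUP\<^bsub>Q\<^esub> y:Y. R (x, y) \<otimes> S (y, z)) \<oplus> T (z, w)"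
      by (intro par.mult_mono_left[simplified]
          tensor.SSUP_upper[where f = "\<lambda>y. R (x, y) \<otimes> S (y, z)"] mem)
    finally show ?thesis
      by (simp add: mem)
  qed
  show ?thesis
    unfolding QRel_hom_le
  proof (intro ballI)
    fix x w assume xw: "x \<in> X" "w \<in> W"
    note mem = QRel_memD[OF R xw(1)] QRel_memD[OF S] QRel_memD[OF T _ xw(2)]
      tensor.mult_closed par_closed tensor.SSUP_closed tensor.IINF_closed
    have "(SSUP\<^bsub>Q\<^esub> y:Y. R (x, y) \<otimes> (IINF\<^bsub>Q\<^esub> z:Z. S (y, z) \<oplus> T (z, w)))
        \<sqsubseteq>\<^bsub>Q\<^esub> (IINF\<^bsub>Q\<^esub> z:Z. (SSUP\<^bsub>Q\<^esub> y:Y. R (x, y) \<otimes> S (y, z)) \<oplus> T (z, w))"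
      by (intro tensor.SSUP_least tensor.IINF_greatest pointwise mem xw)
    then show "QRel_tensor Q (\<otimes>) X Y W R (QRel_par Q (\<oplus>) Y Z W S T) (x, w)
        \<sqsubseteq>\<^bsub>Q\<^esub> QRel_par Q (\<oplus>) X Z W (QRel_tensor Q (\<otimes>) X Y Z R S) T (x, w)"
      using xw by (simp add: QRel_tensor_apply QRel_par_apply cong: SSUP_cong IINF_cong)
  qed
qed

text \<open>The left law for relations over the dual LD-quantale, read in the original
  order.\<close>

lemma (in LD_quantale) QRel_distrib_right:
  assumes R: "R \<in> X \<times> Y \<rightarrow>\<^sub>E carrier Q" and S: "S \<in> Y \<times> Z \<rightarrow>\<^sub>E carrier Q"
    and T: "T \<in> Z \<times> W \<rightarrow>\<^sub>E carrier Q"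
  shows "QRel_tensor Q (\<otimes>) X Z W (QRel_par Q (\<oplus>) X Y Z R S) T
    \<sqsubseteq>\<^bsub>QRel_hom Q X W\<^esub> QRel_par Q (\<oplus>) X Y W R (QRel_tensor Q (\<otimes>) Y Z W S T)"
  using LD_quantale.QRel_distrib_left[OF LD_quantale_dual[OF LD_quantale_axioms], of R X Y S Z T W]
    R S T
  by (simp add: QRel_tensor_dual QRel_par_dual)

lemma (in LD_quantale) QRel_linear_quantaloid:
  "linear_quantaloid \<O> (QRel_hom Q) (QRel_tensor Q (\<otimes>)) (QRel_tident Q tunit)
    (QRel_par Q (\<oplus>)) (QRel_pident Q punit)"
proof (intro linear_quantaloid.intro tensor.QRel_quantaloid
    QRel_par_quantaloid[OF par.unital_quantale_axioms])
  show "linear_quantaloid_axioms \<O> (QRel_hom Q) (QRel_tensor Q (\<otimes>)) (QRel_par Q (\<oplus>))"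
    unfolding linear_quantaloid_axioms_def QRel_hom_carrier
    by (intro conjI allI impI QRel_distrib_left QRel_distrib_right; assumption)
qed

section \<open>Recovering the quantale from relations on a point\<close>

lemma LD_quantaleI_QRel:
  fixes Q :: "'q gorder"
  assumes tensor: "unital_quantale Q tensor tunit"
    and par: "unital_quantale (inv_gorder Q) par punit"
    and linear: "linear_quantaloid (UNIV :: 'u set set) (QRel_hom Q)
      (QRel_tensor Q tensor) tident (QRel_par Q par) pident"
  shows "LD_quantale Q tensor tunit par punit"
proof -
  interpret tensor: unital_quantale Q tensor tunit by (rule tensor)
  interpret par: unital_quantale "inv_gorder Q" par punit by (rule par)
  interpret linear: linear_quantaloid "UNIV :: 'u set set" "QRel_hom Q"
    "QRel_tensor Q tensor" tident "QRel_par Q par" pident by (rule linear)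
  \<comment> \<open>Every type is inhabited, so a one-element set is available as an object; the
    choice of element is immaterial.\<close>
  define p :: 'u where "p = undefined"
  define point where "point a = (\<lambda>_\<in>{p} \<times> {p}. a)" for a :: 'q
  have point_closed: "point a \<in> carrier (QRel_hom Q {p} {p})" if "a \<in> carrier Q" for a
    using that by (simp add: point_def)
  have point_tensor: "QRel_tensor Q tensor {p} {p} {p} (point a) (point b) = point (tensor a b)"
    if "a \<in> carrier Q" "b \<in> carrier Q" for a b
    \<comment> \<open>The composite is a supremum over the single middle point \<open>p\<close>;
      closure ensures that the product is a carrier element and so equals the supremum of its
      singleton.\<close>
    using that tensor.mult_closed[OF that]
    by (auto simp: QRel_tensor_def point_def supr_def fun_eq_iff)
  have point_par: "QRel_par Q par {p} {p} {p} (point a) (point b) = point (par a b)"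
    if "a \<in> carrier Q" "b \<in> carrier Q" for a b
    using that par.mult_closed[of a b]
    by (auto simp: QRel_par_def point_def infi_def fun_eq_iff)
  have point_le: "point a \<sqsubseteq>\<^bsub>QRel_hom Q {p} {p}\<^esub> point b \<longleftrightarrow> a \<sqsubseteq>\<^bsub>Q\<^esub> b" for a b
    by (simp add: point_def)
  show ?thesis
  \<comment> \<open>Both quantale structures are already interpreted, which leaves the two
    distributive laws; each is the law for three relations \<open>point a\<close>,
    \<open>point b\<close>, \<open>point c\<close>.\<close>
  proof unfold_locales
    fix a b c assume abc: "a \<in> carrier Q" "b \<in> carrier Q" "c \<in> carrier Q"
    note closed = abc[THEN point_closed]
    have mem: "tensor a b \<in> carrier Q" "tensor b c \<in> carrier Q"
      "par a b \<in> carrier Q" "par b c \<in> carrier Q"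
      using abc tensor.mult_closed par.mult_closed by simp_all
    show "tensor a (par b c) \<sqsubseteq>\<^bsub>Q\<^esub> par (tensor a b) c"
      using linear.distrib_left[OF UNIV_I UNIV_I UNIV_I UNIV_I closed]
      by (simp only: abc mem point_tensor point_par point_le)
    show "tensor (par a b) c \<sqsubseteq>\<^bsub>Q\<^esub> par a (tensor b c)"
      using linear.distrib_right[OF UNIV_I UNIV_I UNIV_I UNIV_I closed]
      by (simp only: abc mem point_tensor point_par point_le)
  qed
qed

theorem theorem5p2:
  fixes Q :: "'q gorder"
    and tensor par :: "'q \<Rightarrow> 'q \<Rightarrow> 'q"
    and tunit punit :: 'q
  assumes "complete_lattice Q"
    and "unital_quantale Q tensor tunit"
    and "unital_quantale (inv_gorder Q) par punit"
  shows "LD_quantale Q tensor tunit par punit \<longleftrightarrow>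
    linear_quantaloid (UNIV :: 'u set set) (QRel_hom Q)
      (QRel_tensor Q tensor) (QRel_tident Q tunit)
      (QRel_par Q par) (QRel_pident Q punit)"
  by (rule iffI) (erule LD_quantale.QRel_linear_quantaloid, erule LD_quantaleI_QRel[OF assms(2,3)])

end
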